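(* Consider the energy consumption game $\mathcal{G}=(\mathcal{N},\mathcal{X},(b_n^{\mathrm{HP}})_{n\in\mathcal{N}})$ with hourly proportional billing described in the context, with quadratic system costs without constant coefficient, $C_h(\ell)=a_2^h\ell^2+a_1^h\ell$ for every $h\in\mathcal{H}$. Then the price of anarchy of $\mathcal{G}$ satisfies $$\mathrm{PoA}(\mathcal{G})\le 1+\frac34\,\sup_{h\in\mathcal{H}}\frac{1}{1+a_1^h/(a_2^h\,\overline{\ell}^h)}.$$
   Context: Let $\mathcal{N}$ be a finite nonempty set of $N$ users (players) and $\mathcal{H}$ a finite nonempty set of time periods. Each user $n\in\mathcal{N}$ has a finite set $\mathcal{A}_n$ of electric appliances. For each $a\in\mathcal{A}_n$ and $h\in\mathcal{H}$ there are given bounds $0\le\underline{x}_{na}^h\le\overline{x}_{na}^h$, and for each $a\in\mathcal{A}_n$ a given energy requirement $E_{na}\ge 0$. The strategy set $\mathcal{X}_n$ of user $n$ is the set of vectors $\bm{x}_n=(x_{na}^h)_{a\in\mathcal{A}_n,h\in\mathcal{H}}$ of reals satisfying $$\sum_{h\in\mathcal{H}}x_{na}^h=E_{na}\ \ \forall a\in\mathcal{A}_n,\qquad \underline{x}_{na}^h\le x_{na}^h\le\overline{x}_{na}^h\ \ \forall a\in\mathcal{A}_n,\ \forall h\in\mathcal{H}.$$ Each $\mathcal{X}_n$ is assumed nonempty, and $\mathcal{X}=\prod_{n\in\mathcal{N}}\mathcal{X}_n$. For $\bm{x}\in\mathcal{X}$, the load of user $n$ at time $h$ is $\ell_n^h=\sum_{a\in\mathcal{A}_n}x_{na}^h$,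 and the total load at time $h$ is $\ell^h=\sum_{n\in\mathcal{N}}\ell_n^h$. The quantity $\overline{\ell}^h=\sum_{n\in\mathcal{N}}\sum_{a\in\mathcal{A}_n}\overline{x}_{na}^h$ is the upper bound on the total load at time $h$; for an hour $h$ with $\overline{\ell}^h=0$ the quantity $\frac{1}{1+a_1^h/(a_2^h\overline{\ell}^h)}$ is read as $0$. The system cost functions $C_h:[0,\infty)\to\mathbb{R}$ are assumed increasing and strictly convex; for $C_h(\ell)=a_2^h\ell^2+a_1^h\ell$ this means $a_2^h>0$ and $a_1^h\ge0$. Hourly proportional (HP) billing: user $n$ pays $$b_n^{\mathrm{HP}}(\bm{x}_n,\bm{x}_{-n})=\sum_{h\in\mathcal{H}}\frac{\ell_n^h}{\ell^h}\,C_h(\ell^h),$$ the term for $h$ being $0$ when $\ell^h=0$. Here $\bm{x}_{-n}=(\bm{x}_m)_{m\ne n}$. Each user $n$ seeks to minimize $b_n^{\mathrm{HP}}(\cdot,\bm{x}_{-n})$ over $\mathcal{X}_n$. A (pure) Nash equilibrium is a profile $\bm{x}\in\mathcal{X}$ such that for every $n\in\mathcal{N}$ and every $\bm{y}_n\in\mathcal{X}_n$, $b_n^{\mathrm{HP}}(\bm{x}_n,\bm{x}_{-n})\le b_n^{\mathrm{HP}}(\bm{y}_n,\bm{x}_{-n})$. Let $\mathcal{X}_{\mathcal{G}}^{\mathrm{NE}}$ be the set of Nash equilibria. The social cost is $\mathrm{SC}(\bm{x})=\sum_{n\in\mathcal{N}}b_n^{\mathrm{HP}}(\bm{x}_n,\bm{x}_{-n})=\sum_{h\in\mathcal{H}}C_h(\ell^h)$,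 the optimal social cost is $\mathrm{SC}^*=\inf_{\bm{x}\in\mathcal{X}}\mathrm{SC}(\bm{x})$ (assumed positive, i.e. not all $E_{na}$ are zero), and the price of anarchy is $$\mathrm{PoA}(\mathcal{G})=\frac{\sup_{\bm{x}\in\mathcal{X}_{\mathcal{G}}^{\mathrm{NE}}}\mathrm{SC}(\bm{x})}{\mathrm{SC}^*}.$$ *)

theory Defs
  imports "HOL-Analysis.Analysis"
begin

(* The appliance sets of different users share the type 'a but are otherwise unrelated:
   all data of an appliance are indexed by the pair (user, appliance). *)
record ('n, 'a, 'h) energy_game =
  users :: "'n set"
  periods :: "'h set"
  appliances :: "'n \<Rightarrow> 'a set"
  x_min :: "'n \<Rightarrow> 'a \<Rightarrow> 'h \<Rightarrow> real"
  x_max :: "'n \<Rightarrow> 'a \<Rightarrow> 'h \<Rightarrow> real"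
  energy :: "'n \<Rightarrow> 'a \<Rightarrow> real"
  sys_cost :: "'h \<Rightarrow> real \<Rightarrow> real"

(* Strategies and profiles are extensional functions, so that they correspond exactly to
   vectors indexed by appliances and periods, and to families of such vectors indexed by users. *)
definition strategies :: "('n, 'a, 'h) energy_game \<Rightarrow> 'n \<Rightarrow> ('a \<Rightarrow> 'h \<Rightarrow> real) set" where
  "strategies G n =
     {y \<in> (\<Pi>\<^sub>E a\<in>appliances G n. \<Pi>\<^sub>E h\<in>periods G. {x_min G n a h..x_max G n a h}).
        \<forall>a\<in>appliances G n. (\<Sum>h\<in>periods G. y a h) = energy G n a}"

definition profiles :: "('n, 'a, 'h) energy_game \<Rightarrow> ('n \<Rightarrow> 'a \<Rightarrow> 'h \<Rightarrow> real) set" where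
  "profiles G = (\<Pi>\<^sub>E n\<in>users G. strategies G n)"

locale valid_energy_game =
  fixes G :: "('n, 'a, 'h) energy_game"
  assumes finite_users: "finite (users G)"
    and users_nonempty: "users G \<noteq> {}"
    and finite_periods: "finite (periods G)"
    and periods_nonempty: "periods G \<noteq> {}"
    and finite_appliances: "\<And>n. n \<in> users G \<Longrightarrow> finite (appliances G n)"
    and x_min_nonneg:
      "\<And>n a h. \<lbrakk>n \<in> users G; a \<in> appliances G n; h \<in> periods G\<rbrakk> \<Longrightarrow> 0 \<le> x_min G n a h"
    and x_min_le_x_max:
      "\<And>n a h. \<lbrakk>n \<in> users G; a \<in> appliances G n; h \<in> periods G\<rbrakk>
         \<Longrightarrow> x_min G n a h \<le> x_max G n a h"
    and energy_nonneg:
      "\<And>n a. \<lbrakk>n \<in> users G; a \<in> appliances G n\<rbrakk> \<Longrightarrow> 0 \<le> energy G n a"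
    and strategies_nonempty: "\<And>n. n \<in> users G \<Longrightarrow> strategies G n \<noteq> {}"

definition user_load ::
  "('n, 'a, 'h) energy_game \<Rightarrow> ('n \<Rightarrow> 'a \<Rightarrow> 'h \<Rightarrow> real) \<Rightarrow> 'n \<Rightarrow> 'h \<Rightarrow> real" where
  "user_load G x n h = (\<Sum>a\<in>appliances G n. x n a h)"

definition total_load ::
  "('n, 'a, 'h) energy_game \<Rightarrow> ('n \<Rightarrow> 'a \<Rightarrow> 'h \<Rightarrow> real) \<Rightarrow> 'h \<Rightarrow> real" where
  "total_load G x h = (\<Sum>n\<in>users G. user_load G x n h)"

definition max_load :: "('n, 'a, 'h) energy_game \<Rightarrow> 'h \<Rightarrow> real" where
  "max_load G h = (\<Sum>n\<in>users G. \<Sum>a\<in>appliances G n. x_max G n a h)"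

definition hp_bill ::
  "('n, 'a, 'h) energy_game \<Rightarrow> 'n \<Rightarrow> ('n \<Rightarrow> 'a \<Rightarrow> 'h \<Rightarrow> real) \<Rightarrow> real" where
  "hp_bill G n x =
     (\<Sum>h\<in>periods G.
        if total_load G x h = 0 then 0
        else user_load G x n h / total_load G x h * sys_cost G h (total_load G x h))"

definition nash_equilibria :: "('n, 'a, 'h) energy_game \<Rightarrow> ('n \<Rightarrow> 'a \<Rightarrow> 'h \<Rightarrow> real) set" where
  "nash_equilibria G =
     {x \<in> profiles G. \<forall>n\<in>users G. \<forall>y\<in>strategies G n. hp_bill G n x \<le> hp_bill G n (x(n := y))}"

definition social_cost ::
  "('n, 'a, 'h) energy_game \<Rightarrow> ('n \<Rightarrow> 'a \<Rightarrow> 'h \<Rightarrow> real) \<Rightarrow> real" where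
  "social_cost G x = (\<Sum>n\<in>users G. hp_bill G n x)"

definition optimal_social_cost :: "('n, 'a, 'h) energy_game \<Rightarrow> real" where
  "optimal_social_cost G = (INF x\<in>profiles G. social_cost G x)"

(* Both extrema are taken in the reals, so the supremum is meaningful only if equilibria exist
   (for quadratic costs they do: the game has an exact convex potential). *)
definition price_of_anarchy :: "('n, 'a, 'h) energy_game \<Rightarrow> real" where
  "price_of_anarchy G = (SUP x\<in>nash_equilibria G. social_cost G x) / optimal_social_cost G"

(* The quantity 1 / (1 + a1 / (a2 * L)), read as 0 at L = 0.  The case distinction
   is needed: the convention x / 0 = 0 would make the fraction 1 there. *)
definition load_ratio :: "real \<Rightarrow> real \<Rightarrow> real \<Rightarrow> real" where
  "load_ratio a1 a2 L = (if L = 0 then 0 else 1 / (1 + a1 / (a2 * L)))"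

end

theory Submission
  imports Defs
begin

text \<open>
  For quadratic costs the term of period \<open>h\<close> in the bill of user \<open>n\<close> is
  \<open>\<ell>\<^sub>n (a\<^sub>2 \<ell> + a\<^sub>1)\<close>, so the game is an atomic splittable congestion game with affine prices,
  whose price of anarchy is bounded by a local smoothness argument.

  Let \<open>x\<close> be an equilibrium with loads \<open>u\<^sub>n\<close>, \<open>\<ell> = \<Sum> u\<^sub>n\<close>, and \<open>y\<close> any profile with loads
  \<open>v\<^sub>n\<close>, \<open>k = \<Sum> v\<^sub>n\<close>. Moving user \<open>n\<close> an infinitesimal step towards \<open>y\<close> cannot lower the
  bill; summing these first-order conditions over the users gives
  \<open>SC(x) \<le> \<Sum>\<^sub>h (a\<^sub>2 \<ell> k + a\<^sub>1 k + a\<^sub>2 \<Sum>\<^sub>n (u\<^sub>n v\<^sub>n - u\<^sub>n\<^sup>2))\<close>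
  (lemmas \<open>nash_variational_inequality\<close> and \<open>nash_first_order_bound\<close>).
  Here \<open>\<Sum>\<^sub>n (u\<^sub>n v\<^sub>n - u\<^sub>n\<^sup>2) \<le> \<Sum>\<^sub>n v\<^sub>n\<^sup>2 / 4 \<le> k\<^sup>2 / 4\<close>, and \<open>\<ell> k \<le> \<ell>\<^sup>2 / 3 + 3 k\<^sup>2 / 4\<close>, with
  weights chosen so that the terms in \<open>k\<close> add up to exactly \<open>a\<^sub>2 k\<^sup>2 + a\<^sub>1 k\<close>. Hence
  \<open>SC(x) \<le> SC(y) + (\<Sum>\<^sub>h a\<^sub>2 \<ell>\<^sup>2) / 3\<close>.

  The linear part of the cost enters through the share of the quadratic term: as
  \<open>\<ell> \<le> \<ell>\<^sub>m\<^sub>a\<^sub>x\<close>, we have \<open>a\<^sub>2 \<ell>\<^sup>2 \<le> r (a\<^sub>2 \<ell>\<^sup>2 + a\<^sub>1 \<ell>)\<close> with \<open>r\<close> the largest load ratio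
  (lemma \<open>load_ratio_quadratic_share\<close>). So \<open>(1 - r/3) SC(x) \<le> SC(y)\<close>, and since
  \<open>0 \<le> r \<le> 1\<close> this yields a price of anarchy of at most \<open>1 + r/2 \<le> 1 + 3r/4\<close>.

  As the supremum over the equilibria is a supremum of reals, it is also necessary to know that
  an equilibrium exists. The game has an exact potential (lemma \<open>exact_potential\<close>), which is
  continuous and hence attains its minimum on the compact set of profiles; a minimiser is an
  equilibrium (lemma \<open>nash_equilibrium_exists\<close>).
\<close>

section \<open>Two elementary inequalities\<close>

text \<open>Cross-multiplied, the inequality says \<open>\<ell> \<le> L\<close>: the quadratic term has the largest share of
  the cost at full load.\<close>

lemma load_ratio_quadratic_share:
  fixes \<alpha> \<beta> l L :: real
  assumes "0 < \<beta>" "0 \<le> \<alpha>" "0 \<le> l" "l \<le> L"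
  shows "\<beta> * l\<^sup>2 \<le> load_ratio \<alpha> \<beta> L * (\<beta> * l\<^sup>2 + \<alpha> * l)"
proof (cases "L = 0")
  case True
  then show ?thesis using assms by simp
next
  case False
  then have L: "0 < L" using assms by simp
  have pos: "0 < \<beta> * L + \<alpha>" using L assms by (simp add: add_pos_nonneg)
  have ratio: "load_ratio \<alpha> \<beta> L = \<beta> * L / (\<beta> * L + \<alpha>)"
    using L assms pos by (simp add: load_ratio_def field_simps)
  have "\<alpha> * \<beta> * l * l \<le> \<alpha> * \<beta> * l * L"
    using assms by (intro mult_left_mono) auto
  then have "\<beta> * l\<^sup>2 * (\<beta> * L + \<alpha>) \<le> \<beta> * L * (\<beta> * l\<^sup>2 + \<alpha> * l)"
    by (simp add: algebra_simps power2_eq_square)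
  then show ?thesis
    using pos by (simp add: ratio field_simps)
qed

lemma load_ratio_bounds:
  assumes "0 < \<beta>" "0 \<le> \<alpha>" "0 \<le> L"
  shows "0 \<le> load_ratio \<alpha> \<beta> L" "load_ratio \<alpha> \<beta> L \<le> 1"
  using assms by (auto simp: load_ratio_def divide_simps add_pos_nonneg)

text \<open>This is the local smoothness inequality of affine splittable congestion games, for a single
  resource. Each summand of the second sum is at most \<open>v\<^sub>n\<^sup>2 / 4\<close>, which is where the splittable
  setting pays off: the squares \<open>u\<^sub>n\<^sup>2\<close> absorb the mixed terms.\<close>

lemma splittable_smoothness:
  fixes u v :: "'i \<Rightarrow> real"
  assumes "\<And>i. i \<in> I \<Longrightarrow> 0 \<le> v i"
  shows "sum u I * sum v I + (\<Sum>i\<in>I. u i * v i - (u i)\<^sup>2) \<le> (sum u I)\<^sup>2 / 3 + (sum v I)\<^sup>2"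
proof -
  have young: "u i * v i - (u i)\<^sup>2 \<le> (v i)\<^sup>2 / 4" for i
    using zero_le_power2[of "u i - v i / 2"] by (simp add: power2_eq_square algebra_simps)
  have "(\<Sum>i\<in>I. u i * v i - (u i)\<^sup>2) \<le> (\<Sum>i\<in>I. (v i)\<^sup>2) / 4"
    unfolding sum_divide_distrib by (intro sum_mono young)
  also have "(\<Sum>i\<in>I. (v i)\<^sup>2) \<le> (sum v I)\<^sup>2"
  proof (cases "finite I")
    case True
    have "(\<Sum>i\<in>I. (v i)\<^sup>2) \<le> (\<Sum>i\<in>I. v i * sum v I)"
      unfolding power2_eq_square
      using assms True by (intro sum_mono mult_left_mono member_le_sum) auto
    then show ?thesis by (simp add: sum_distrib_right power2_eq_square)
  qed simp
  finally have "(\<Sum>i\<in>I. u i * v i - (u i)\<^sup>2) \<le> (sum v I)\<^sup>2 / 4" by simp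
  moreover have "sum u I * sum v I \<le> (sum u I)\<^sup>2 / 3 + 3 / 4 * (sum v I)\<^sup>2"
    using zero_le_power2[of "sum u I - 3 / 2 * sum v I"]
    by (simp add: power2_eq_square algebra_simps)
  ultimately show ?thesis by linarith
qed

section \<open>Profiles and loads\<close>

text \<open>Compactness is meant in the product topology of the full function space. An extensional
  product is a product over the whole index type whose remaining factors are the singleton of the
  default value, so Tychonoff's theorem applies to it.\<close>

lemma compact_PiE:
  fixes S :: "'i \<Rightarrow> 'b::topological_space set"
  assumes "\<And>i. i \<in> I \<Longrightarrow> compact (S i)"
  shows "compact (PiE I S)"
proof -
  have "PiE I S = PiE UNIV (\<lambda>i. if i \<in> I then S i else {undefined})"
    by (auto simp: PiE_iff extensional_def split: if_splits)
  moreover have "compactin (product_topology (\<lambda>_. euclidean) UNIV)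
      (PiE UNIV (\<lambda>i. if i \<in> I then S i else {undefined :: 'b}))"
    using assms by (auto simp: compactin_PiE)
  ultimately show ?thesis
    by (simp add: euclidean_product_topology)
qed

context valid_energy_game
begin

lemma profile_strategy: "x \<in> profiles G \<Longrightarrow> n \<in> users G \<Longrightarrow> x n \<in> strategies G n"
  by (auto simp: profiles_def)

lemma strategy_bounds:
  assumes "y \<in> strategies G n" "a \<in> appliances G n" "h \<in> periods G"
  shows "x_min G n a h \<le> y a h" "y a h \<le> x_max G n a h"
  using assms by (fastforce simp: strategies_def PiE_iff)+

lemma profile_update:
  assumes "x \<in> profiles G" "n \<in> users G" "y \<in> strategies G n"
  shows "x(n := y) \<in> profiles G"
  using assms by (auto simp: profiles_def PiE_iff extensional_def)

lemma profiles_nonempty: "profiles G \<noteq> {}"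
  using strategies_nonempty by (auto simp: profiles_def PiE_eq_empty_iff)

lemma strategy_mix:
  assumes y: "y \<in> strategies G n" and z: "z \<in> strategies G n" and t: "0 \<le> t" "t \<le> (1::real)"
  shows "(\<lambda>a\<in>appliances G n. \<lambda>h\<in>periods G. y a h + t * (z a h - y a h)) \<in> strategies G n"
proof -
  have "y a h + t * (z a h - y a h) \<in> {x_min G n a h..x_max G n a h}"
    if "a \<in> appliances G n" "h \<in> periods G" for a h
  proof -
    have "(1 - t) *\<^sub>R y a h + t *\<^sub>R z a h \<in> {x_min G n a h..x_max G n a h}"
      using t strategy_bounds[OF y that] strategy_bounds[OF z that]
      by (intro convexD[OF convex_real_interval(5)]) auto
    then show ?thesis by (simp add: algebra_simps)
  qed
  moreover have "(\<Sum>h\<in>periods G. y a h + t * (z a h - y a h)) = energy G n a"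
    if "a \<in> appliances G n" for a
    using y z that
    by (simp add: strategies_def sum.distrib sum_subtractf flip: sum_distrib_left)
  ultimately show ?thesis by (auto simp: strategies_def)
qed

lemma user_load_nonneg:
  assumes "x \<in> profiles G" "n \<in> users G" "h \<in> periods G"
  shows "0 \<le> user_load G x n h"
  unfolding user_load_def
proof (intro sum_nonneg)
  fix a assume "a \<in> appliances G n"
  then show "0 \<le> x n a h"
    using x_min_nonneg[of n a h] strategy_bounds(1)[OF profile_strategy[OF assms(1,2)]] assms
    by (meson order_trans)
qed

lemma total_load_nonneg:
  "x \<in> profiles G \<Longrightarrow> h \<in> periods G \<Longrightarrow> 0 \<le> total_load G x h"
  unfolding total_load_def by (intro sum_nonneg user_load_nonneg)

lemma total_load_le_max_load:
  "x \<in> profiles G \<Longrightarrow> h \<in> periods G \<Longrightarrow> total_load G x h \<le> max_load G h"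
  unfolding total_load_def max_load_def user_load_def
  by (intro sum_mono strategy_bounds(2) profile_strategy)

lemma max_load_nonneg: "h \<in> periods G \<Longrightarrow> 0 \<le> max_load G h"
  using profiles_nonempty total_load_nonneg total_load_le_max_load by (meson ex_in_conv order_trans)

lemma sum_user_load_update:
  assumes "n \<in> users G"
  shows "(\<Sum>m\<in>users G. f (user_load G (x(n := y)) m h)) =
    (\<Sum>m\<in>users G. f (user_load G x m h))
      + (f (user_load G (x(n := y)) n h) - f (user_load G x n h) :: real)"
proof -
  have "(\<Sum>m\<in>users G - {n}. f (user_load G (x(n := y)) m h)) =
      (\<Sum>m\<in>users G - {n}. f (user_load G x m h))"
    by (intro sum.cong) (auto simp: user_load_def)
  then show ?thesis
    using finite_users assms by (simp add: sum.remove[of "users G" n])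
qed

lemma total_load_update:
  assumes "n \<in> users G"
  shows "total_load G (x(n := y)) h =
    total_load G x h + (user_load G (x(n := y)) n h - user_load G x n h)"
  unfolding total_load_def using sum_user_load_update[OF assms, of "\<lambda>l. l"] .

lemma compact_profiles: "compact (profiles G)"
  unfolding profiles_def
proof (intro compact_PiE)
  fix n assume n: "n \<in> users G"
  define B where "B = (\<Pi>\<^sub>E a\<in>appliances G n. \<Pi>\<^sub>E h\<in>periods G. {x_min G n a h..x_max G n a h})"
  have "compact B"
    unfolding B_def by (intro compact_PiE compact_Icc)
  moreover have "closed {y :: 'a \<Rightarrow> 'h \<Rightarrow> real. (\<Sum>h\<in>periods G. y a h) = energy G n a}" for a
    by (intro closed_Collect_eq continuous_on_sum continuous_on_const
        continuous_on_product_then_coordinatewise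
          [OF continuous_on_product_then_coordinatewise[OF continuous_on_id]])
  then have "closed (\<Inter>a\<in>appliances G n.
      {y :: 'a \<Rightarrow> 'h \<Rightarrow> real. (\<Sum>h\<in>periods G. y a h) = energy G n a})"
    by blast
  moreover have "strategies G n = B \<inter> (\<Inter>a\<in>appliances G n.
      {y. (\<Sum>h\<in>periods G. y a h) = energy G n a})"
    by (auto simp: strategies_def B_def)
  ultimately show "compact (strategies G n)"
    by (simp add: compact_Int_closed)
qed

lemma continuous_user_load: "continuous_on A (\<lambda>x. user_load G x n h)"
  unfolding user_load_def
  by (intro continuous_on_sum continuous_on_product_then_coordinatewise
      [OF continuous_on_product_then_coordinatewise
        [OF continuous_on_product_then_coordinatewise[OF continuous_on_id]]])

end

section \<open>Quadratic costs\<close>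

locale quadratic_energy_game = valid_energy_game G
  for G :: "('n, 'a, 'h) energy_game" +
  fixes a1 a2 :: "'h \<Rightarrow> real"
  assumes a2_pos: "\<And>h. h \<in> periods G \<Longrightarrow> 0 < a2 h"
    and a1_nonneg: "\<And>h. h \<in> periods G \<Longrightarrow> 0 \<le> a1 h"
    and sys_cost_quadratic:
      "\<And>h l. h \<in> periods G \<Longrightarrow> 0 \<le> l \<Longrightarrow> sys_cost G h l = a2 h * l\<^sup>2 + a1 h * l"
begin

text \<open>In a period with total load \<open>0\<close> every user load vanishes, so that the product gives the
  value \<open>0\<close> prescribed for such a period.\<close>

lemma hp_bill_quadratic:
  assumes x: "x \<in> profiles G" and n: "n \<in> users G"
  shows "hp_bill G n x =
    (\<Sum>h\<in>periods G. user_load G x n h * (a2 h * total_load G x h + a1 h))"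
  unfolding hp_bill_def
proof (intro sum.cong refl)
  fix h assume h: "h \<in> periods G"
  show "(if total_load G x h = 0 then 0
      else user_load G x n h / total_load G x h * sys_cost G h (total_load G x h)) =
    user_load G x n h * (a2 h * total_load G x h + a1 h)"
  proof (cases "total_load G x h = 0")
    case True
    then have "user_load G x n h = 0"
      using finite_users n user_load_nonneg[OF x _ h]
      by (simp add: total_load_def sum_nonneg_eq_0_iff)
    then show ?thesis using True by simp
  next
    case False
    then show ?thesis
      using h sys_cost_quadratic[OF h total_load_nonneg[OF x h]]
      by (simp add: field_simps power2_eq_square)
  qed
qed

lemma social_cost_quadratic:
  assumes "x \<in> profiles G"
  shows "social_cost G x =
    (\<Sum>h\<in>periods G. a2 h * (total_load G x h)\<^sup>2 + a1 h * total_load G x h)"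
proof -
  have "social_cost G x =
      (\<Sum>h\<in>periods G. \<Sum>n\<in>users G. user_load G x n h * (a2 h * total_load G x h + a1 h))"
    unfolding social_cost_def using assms by (subst sum.swap) (simp add: hp_bill_quadratic)
  also have "\<dots> = (\<Sum>h\<in>periods G. total_load G x h * (a2 h * total_load G x h + a1 h))"
    by (simp flip: sum_distrib_right total_load_def)
  finally show ?thesis by (simp add: power2_eq_square algebra_simps)
qed

section \<open>Existence of equilibria\<close>

text \<open>A user whose load is \<open>u\<close> at total load \<open>\<ell>\<close> has the marginal bill \<open>a\<^sub>2 (\<ell> + u) + a\<^sub>1\<close>. This is
  the partial derivative of the function below, in which the squares of the single loads
  account for the summand \<open>a\<^sub>2 u\<close>.\<close>

definition potential :: "('n \<Rightarrow> 'a \<Rightarrow> 'h \<Rightarrow> real) \<Rightarrow> real" where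
  "potential x = (\<Sum>h\<in>periods G.
     a2 h / 2 * ((total_load G x h)\<^sup>2 + (\<Sum>n\<in>users G. (user_load G x n h)\<^sup>2))
       + a1 h * total_load G x h)"

lemma exact_potential:
  assumes x: "x \<in> profiles G" and n: "n \<in> users G" and y: "y \<in> strategies G n"
  shows "hp_bill G n (x(n := y)) - hp_bill G n x = potential (x(n := y)) - potential x"
  unfolding hp_bill_quadratic[OF x n] hp_bill_quadratic[OF profile_update[OF x n y] n]
    potential_def sum_subtractf[symmetric]
    total_load_update[OF n] sum_user_load_update[OF n, of "\<lambda>l. l\<^sup>2"]
  by (intro sum.cong refl) (simp add: power2_eq_square field_simps)

lemma nash_equilibrium_exists: "nash_equilibria G \<noteq> {}"
proof -
  have "continuous_on (profiles G) potential"
    unfolding potential_def total_load_def by (intro continuous_intros continuous_user_load)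
  then obtain x where x: "x \<in> profiles G"
    and le: "\<And>z. z \<in> profiles G \<Longrightarrow> potential x \<le> potential z"
    using continuous_attains_inf[OF compact_profiles profiles_nonempty] by blast
  have "hp_bill G n x \<le> hp_bill G n (x(n := y))"
    if "n \<in> users G" "y \<in> strategies G n" for n y
    using exact_potential[OF x that] le[OF profile_update[OF x that]] by linarith
  then show ?thesis using x by (auto simp: nash_equilibria_def)
qed

section \<open>The bound on the social cost of equilibria\<close>

lemma nash_variational_inequality:
  assumes x: "x \<in> nash_equilibria G" and y: "y \<in> profiles G" and n: "n \<in> users G"
  shows "0 \<le> (\<Sum>h\<in>periods G. (a2 h * (total_load G x h + user_load G x n h) + a1 h)
    * (user_load G y n h - user_load G x n h))"
proof -
  have xp: "x \<in> profiles G" using x by (simp add: nash_equilibria_def)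
  define d where "d h = user_load G y n h - user_load G x n h" for h
  define D where
    "D = (\<Sum>h\<in>periods G. (a2 h * (total_load G x h + user_load G x n h) + a1 h) * d h)"
  define Q where "Q = (\<Sum>h\<in>periods G. a2 h * (d h)\<^sup>2)"
  \<comment> \<open>Along the segment from \<open>x n\<close> to \<open>y n\<close> the bill grows by the quadratic polynomial \<open>t D + t\<^sup>2 Q\<close>,
    whose derivative at \<open>t = 0\<close> is \<open>D\<close>.\<close>
  have poly: "0 \<le> t * D + t\<^sup>2 * Q" if t: "0 \<le> t" "t \<le> 1" for t
  proof -
    define z where
      "z = (\<lambda>a\<in>appliances G n. \<lambda>h\<in>periods G. x n a h + t * (y n a h - x n a h))"
    have z: "z \<in> strategies G n"
      unfolding z_def by (intro strategy_mix profile_strategy xp y n t)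
    have load: "user_load G (x(n := z)) n h = user_load G x n h + t * d h"
      if "h \<in> periods G" for h
      using that
      by (simp add: user_load_def z_def d_def sum.distrib sum_subtractf flip: sum_distrib_left)
    have "hp_bill G n (x(n := z)) - hp_bill G n x = t * D + t\<^sup>2 * Q"
      unfolding hp_bill_quadratic[OF xp n] hp_bill_quadratic[OF profile_update[OF xp n z] n]
        sum_subtractf[symmetric] D_def Q_def sum_distrib_left sum.distrib[symmetric]
        total_load_update[OF n]
      by (intro sum.cong refl) (simp add: load power2_eq_square algebra_simps)
    moreover have "hp_bill G n x \<le> hp_bill G n (x(n := z))"
      using x n z by (simp add: nash_equilibria_def)
    ultimately show ?thesis by linarith
  qed
  have quotient: "0 \<le> D + t * Q" if "0 < t" "t \<le> 1" for t
  proof -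
    have "0 \<le> t * (D + t * Q)"
      using poly[of t] that by (simp add: power2_eq_square algebra_simps)
    then show ?thesis using that by (simp add: zero_le_mult_iff)
  qed
  have "((\<lambda>t. D + t * Q) \<longlongrightarrow> D + 0 * Q) (at_right 0)"
    by (intro tendsto_intros)
  moreover have "\<forall>\<^sub>F t in at_right 0. 0 \<le> D + t * Q"
    using quotient by (intro eventually_at_rightI[of 0 1]) auto
  ultimately have "0 \<le> D"
    using tendsto_lowerbound[of _ "D + 0 * Q"] by fastforce
  then show ?thesis by (simp add: D_def d_def)
qed

lemma nash_first_order_bound:
  assumes x: "x \<in> nash_equilibria G" and y: "y \<in> profiles G"
  shows "social_cost G x \<le> (\<Sum>h\<in>periods G.
    a2 h * (total_load G x h * total_load G y h
      + (\<Sum>n\<in>users G. user_load G x n h * user_load G y n h - (user_load G x n h)\<^sup>2))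
    + a1 h * total_load G y h)"
    (is "_ \<le> sum ?R _")
proof -
  have xp: "x \<in> profiles G" using x by (simp add: nash_equilibria_def)
  let ?C = "\<lambda>h. a2 h * (total_load G x h)\<^sup>2 + a1 h * total_load G x h"
  have "0 \<le> (\<Sum>n\<in>users G. \<Sum>h\<in>periods G.
      (a2 h * (total_load G x h + user_load G x n h) + a1 h)
        * (user_load G y n h - user_load G x n h))"
    by (intro sum_nonneg nash_variational_inequality x y)
  also have "\<dots> = (\<Sum>h\<in>periods G. ?R h - ?C h)"
    unfolding sum.swap[of _ "periods G" "users G"]
  proof (intro sum.cong refl)
    fix h
    show "(\<Sum>n\<in>users G. (a2 h * (total_load G x h + user_load G x n h) + a1 h)
        * (user_load G y n h - user_load G x n h)) = ?R h - ?C h" (is "?S = _")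
    proof -
      have "?S = (\<Sum>n\<in>users G.
          (a2 h * total_load G x h + a1 h) * (user_load G y n h - user_load G x n h)
          + a2 h * (user_load G x n h * user_load G y n h - (user_load G x n h)\<^sup>2))"
        by (intro sum.cong refl) (simp add: power2_eq_square algebra_simps)
      also have "\<dots> =
          (a2 h * total_load G x h + a1 h) * (total_load G y h - total_load G x h)
          + a2 h * (\<Sum>n\<in>users G. user_load G x n h * user_load G y n h
              - (user_load G x n h)\<^sup>2)"
        unfolding sum.distrib sum_distrib_left[symmetric]
        by (simp add: total_load_def sum_subtractf)
      finally show ?thesis by (simp add: power2_eq_square algebra_simps)
    qed
  qed
  finally show ?thesis
    by (simp add: social_cost_quadratic[OF xp] sum_subtractf)
qed

abbreviation max_ratio :: real where
  "max_ratio \<equiv> (SUP h\<in>periods G. load_ratio (a1 h) (a2 h) (max_load G h))"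

lemma load_ratio_le_max_ratio:
  "h \<in> periods G \<Longrightarrow> load_ratio (a1 h) (a2 h) (max_load G h) \<le> max_ratio"
  using finite_periods by (intro cSUP_upper bdd_above_finite) auto

lemma max_ratio_bounds: "0 \<le> max_ratio" "max_ratio \<le> 1"
proof -
  obtain h where h: "h \<in> periods G" using periods_nonempty by blast
  show "0 \<le> max_ratio"
    using load_ratio_bounds(1)[OF a2_pos[OF h] a1_nonneg[OF h] max_load_nonneg[OF h]]
      load_ratio_le_max_ratio[OF h] by linarith
  show "max_ratio \<le> 1"
    using periods_nonempty
    by (intro cSUP_least load_ratio_bounds(2) a2_pos a1_nonneg max_load_nonneg)
qed

lemma quadratic_cost_share:
  assumes x: "x \<in> profiles G"
  shows "(\<Sum>h\<in>periods G. a2 h * (total_load G x h)\<^sup>2) \<le> max_ratio * social_cost G x"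
  unfolding social_cost_quadratic[OF x] sum_distrib_left
proof (intro sum_mono)
  fix h assume h: "h \<in> periods G"
  let ?C = "a2 h * (total_load G x h)\<^sup>2 + a1 h * total_load G x h"
  have "a2 h * (total_load G x h)\<^sup>2 \<le> load_ratio (a1 h) (a2 h) (max_load G h) * ?C"
    by (intro load_ratio_quadratic_share a2_pos a1_nonneg total_load_nonneg
        total_load_le_max_load x h)
  also have "\<dots> \<le> max_ratio * ?C"
    using a2_pos[OF h] a1_nonneg[OF h] total_load_nonneg[OF x h]
    by (intro mult_right_mono load_ratio_le_max_ratio h) auto
  finally show "a2 h * (total_load G x h)\<^sup>2 \<le> max_ratio * ?C" .
qed

lemma nash_social_cost_bound:
  assumes x: "x \<in> nash_equilibria G" and y: "y \<in> profiles G"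
  shows "(1 - max_ratio / 3) * social_cost G x \<le> social_cost G y"
proof -
  have xp: "x \<in> profiles G" using x by (simp add: nash_equilibria_def)
  have "social_cost G x \<le> (\<Sum>h\<in>periods G.
      a2 h * (total_load G x h * total_load G y h
        + (\<Sum>n\<in>users G. user_load G x n h * user_load G y n h - (user_load G x n h)\<^sup>2))
      + a1 h * total_load G y h)"
    by (rule nash_first_order_bound[OF x y])
  also have "\<dots> \<le> (\<Sum>h\<in>periods G.
      a2 h * ((total_load G x h)\<^sup>2 / 3 + (total_load G y h)\<^sup>2) + a1 h * total_load G y h)"
    unfolding total_load_def
    by (intro sum_mono add_right_mono mult_left_mono splittable_smoothness
        user_load_nonneg y less_imp_le[OF a2_pos])
  also have "\<dots> = (\<Sum>h\<in>periods G. a2 h * (total_load G x h)\<^sup>2) / 3 + social_cost G y"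
    by (simp add: social_cost_quadratic[OF y] sum_divide_distrib sum.distrib[symmetric]
        algebra_simps)
  finally show ?thesis
    using quadratic_cost_share[OF xp] by (simp add: algebra_simps)
qed

lemma price_of_anarchy_le:
  assumes pos: "0 < optimal_social_cost G"
  shows "price_of_anarchy G \<le> 1 + max_ratio / 2"
proof -
  let ?r = max_ratio and ?O = "optimal_social_cost G"
  note r = max_ratio_bounds
  have "social_cost G x \<le> (1 + ?r / 2) * ?O" if x: "x \<in> nash_equilibria G" for x
  proof -
    have opt: "(1 - ?r / 3) * social_cost G x \<le> ?O"
      unfolding optimal_social_cost_def
      by (intro cINF_greatest profiles_nonempty nash_social_cost_bound x)
    \<comment> \<open>The product \<open>(1 + r/2) (1 - r/3)\<close> is \<open>1 + r (1 - r) / 6\<close>.\<close>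
    have "0 \<le> ?r * (1 - ?r)" using r by simp
    then have "1 \<le> (1 + ?r / 2) * (1 - ?r / 3)" by (simp add: field_simps)
    then have "?O \<le> (1 + ?r / 2) * (1 - ?r / 3) * ?O"
      using mult_right_mono[of 1 _ ?O] pos by simp
    then have "(1 - ?r / 3) * social_cost G x \<le> (1 - ?r / 3) * ((1 + ?r / 2) * ?O)"
      using opt by (simp add: mult_ac)
    then show ?thesis using r by (simp add: mult_le_cancel_left_pos)
  qed
  then have "(SUP x\<in>nash_equilibria G. social_cost G x) \<le> (1 + ?r / 2) * ?O"
    by (intro cSUP_least nash_equilibrium_exists)
  then show ?thesis
    using pos by (simp add: price_of_anarchy_def pos_divide_le_eq)
qed

end

section \<open>The price of anarchy\<close>

theorem theorem2:
  fixes G :: "('n, 'a, 'h) energy_game"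
    and a1 a2 :: "'h \<Rightarrow> real"
  assumes "valid_energy_game G"
    and "\<And>h. h \<in> periods G \<Longrightarrow> 0 < a2 h"
    and "\<And>h. h \<in> periods G \<Longrightarrow> 0 \<le> a1 h"
    and "\<And>h l. \<lbrakk>h \<in> periods G; 0 \<le> l\<rbrakk> \<Longrightarrow> sys_cost G h l = a2 h * l\<^sup>2 + a1 h * l"
    and "0 < optimal_social_cost G"
  shows "price_of_anarchy G
           \<le> 1 + 3 / 4 * (SUP h\<in>periods G. load_ratio (a1 h) (a2 h) (max_load G h))"
proof -
  interpret quadratic_energy_game G a1 a2
    using assms(1-4) by (auto simp: quadratic_energy_game_def quadratic_energy_game_axioms_def)
  show ?thesis
    using price_of_anarchy_le[OF assms(5)] max_ratio_bounds(1) by linarith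
qed

end
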